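(* There exists a function $f\colon\mathbb{R}\to\mathbb{R}$ with countable bounded range such that for every $x\in\mathbb{R}$ there exists an $\varepsilon_x>0$ with the property that the set \[ S_x=\{s\in\mathbb{R}\colon |f(x-s)-f(x+s)|<\varepsilon_x\} \] is finite. In particular $f$ is uniformly antisymmetric.
   Context: A function $f\colon\mathbb{R}\to\mathbb{R}$ is called uniformly antisymmetric if for every $x\in\mathbb{R}$ there is no sequence $\{s_n\}_{n<\omega}$ of real numbers converging to $0$ such that $\lim_{n\to\infty}(f(x+s_n)-f(x-s_n))=0$.
   Formalization: In the definition of uniformly antisymmetric, the sequences converging to 0 are required to have nonzero terms; otherwise the constant sequence 0 would show that no function is uniformly antisymmetric. *)

theory Defs
  imports "HOL-Analysis.Analysis"
begin

(* The terms of the sequences are required to be nonzero: the constant sequence 0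
   would otherwise violate the condition for every f. *)
definition uniformly_antisymmetric :: "(real \<Rightarrow> real) \<Rightarrow> bool" where
  "uniformly_antisymmetric f \<longleftrightarrow>
    (\<forall>x. \<not> (\<exists>s :: nat \<Rightarrow> real. (\<forall>n. s n \<noteq> 0) \<and> s \<longlonglongrightarrow> 0 \<and>
      (\<lambda>n. f (x + s n) - f (x - s n)) \<longlonglongrightarrow> 0))"

end

theory Submission
  imports Defs
begin

text \<open>
  Fix rational coordinates of the reals with respect to a Hamel basis, and read off from each
  real a finite set of bits; the function is the ternary number with these digits, so its values
  are close only if long initial segments of the bits agree. The bits of a real are sorted by
  cells of the basis elements. If a cell contains at most one basis element \<open>\<beta>\<close> of the support
  of \<open>x\<close>, then off \<open>\<beta>\<close> the coordinates of \<open>x - s\<close> and \<open>x + s\<close> in this cell are opposite, so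
  the parity of the support and the signs of the first two coordinates (the first one also
  compared with that of \<open>x\<close> at \<open>\<beta>\<close>) tell the two points apart. To keep the range countable, the
  bits are only recorded up to a level at which the cells separate the support; if both points
  stop before the level of \<open>x\<close>, then each cell holds at most one element of either support, and
  the signs force the supports to lie inside that of \<open>x\<close>. Bounding the coordinates by the
  level leaves only finitely many such points.
\<close>

section \<open>Ternary sums\<close>

definition ternary :: "nat set \<Rightarrow> real" where
  "ternary A = (\<Sum>i\<in>A. (1/3) ^ i)"

lemma ternary_nonneg: "0 \<le> ternary A"
  unfolding ternary_def by (intro sum_nonneg) simp

lemma ternary_tail_le:
  assumes "finite A" "A \<subseteq> {k..}"
  shows "ternary A \<le> 3/2 * (1/3) ^ k"
proof -
  obtain n where "A \<subseteq> {..<n}"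
    using finite_nat_iff_bounded[of A] assms(1) by blast
  then have "A \<subseteq> {k..<k+n}"
    using assms(2) by fastforce
  then have "ternary A \<le> (\<Sum>i\<in>{k..<k+n}. (1/3) ^ i)"
    unfolding ternary_def by (intro sum_mono2) auto
  also have "\<dots> = 3/2 * ((1/3) ^ k - (1/3) ^ (k+n))"
    by (induction n) (simp_all add: algebra_simps)
  also have "\<dots> \<le> 3/2 * (1/3) ^ k"
    by simp
  finally show ?thesis .
qed

lemma ternary_split:
  assumes "finite A"
  shows "ternary A = ternary (A \<inter> {..<k}) + (if k \<in> A then (1/3) ^ k else 0)
           + ternary (A \<inter> {Suc k..})"
proof -
  have "A = (A \<inter> {..<k}) \<union> (A \<inter> {k}) \<union> (A \<inter> {Suc k..})"
    by fastforce
  then have "ternary A = ternary ((A \<inter> {..<k}) \<union> (A \<inter> {k}) \<union> (A \<inter> {Suc k..}))"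
    by simp
  also have "\<dots> = ternary ((A \<inter> {..<k}) \<union> (A \<inter> {k})) + ternary (A \<inter> {Suc k..})"
    unfolding ternary_def using assms by (intro sum.union_disjoint) auto
  also have "ternary ((A \<inter> {..<k}) \<union> (A \<inter> {k})) = ternary (A \<inter> {..<k}) + ternary (A \<inter> {k})"
    unfolding ternary_def using assms by (intro sum.union_disjoint) auto
  also have "ternary (A \<inter> {k}) = (if k \<in> A then (1/3) ^ k else 0)"
    by (simp add: ternary_def)
  finally show ?thesis .
qed

text \<open>At the first index \<open>k\<close> below \<open>N\<close> where the sets differ, one
  sum gains (1/3)^k, while the tails beyond \<open>k\<close> can offset at most half of it. What
  remains is at least (1/3)^k / 2, which exceeds (1/3)^N. Base 2 would leave no such margin.\<close>

lemma ternary_less_imp_same_digits: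
  assumes "finite A" "finite B" and close: "\<bar>ternary A - ternary B\<bar> < (1/3) ^ N"
  shows "A \<inter> {..<N} = B \<inter> {..<N}"
proof (rule ccontr)
  assume "A \<inter> {..<N} \<noteq> B \<inter> {..<N}"
  then have ex: "\<exists>k. k < N \<and> (k \<in> A) \<noteq> (k \<in> B)"
    by blast
  define k where "k = (LEAST k. k < N \<and> (k \<in> A) \<noteq> (k \<in> B))"
  have k: "k < N" "(k \<in> A) \<noteq> (k \<in> B)"
    using LeastI_ex[OF ex] by (auto simp: k_def)
  have "(j \<in> A) = (j \<in> B)" if "j < k" for j
    using not_less_Least[of j "\<lambda>k. k < N \<and> (k \<in> A) \<noteq> (k \<in> B)"] that k(1)
    by (auto simp: k_def)
  then have *: "A \<inter> {..<k} = B \<inter> {..<k}"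
    by auto
  have "ternary (A \<inter> {Suc k..}) \<le> (1/3) ^ k / 2" "ternary (B \<inter> {Suc k..}) \<le> (1/3) ^ k / 2"
    using ternary_tail_le[of "A \<inter> {Suc k..}" "Suc k"] ternary_tail_le[of "B \<inter> {Suc k..}" "Suc k"]
      assms by simp_all
  moreover have "(1/3::real) ^ N \<le> (1/3) ^ k / 2"
  proof -
    have "(1/3::real) ^ N \<le> (1/3) ^ Suc k"
      using k(1) by (intro power_decreasing) auto
    also have "\<dots> \<le> (1/3) ^ k / 2"
      by simp
    finally show ?thesis .
  qed
  ultimately show False
    using k(2) close ternary_split[OF assms(1), of k] ternary_split[OF assms(2), of k] *
      ternary_nonneg[of "A \<inter> {Suc k..}"] ternary_nonneg[of "B \<inter> {Suc k..}"]
    by (auto split: if_splits)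
qed

section \<open>Cells\<close>

text \<open>The rationals numbered below \<open>n\<close> cut the line into finitely many intervals;
  the list names the one containing \<open>b\<close>. Larger \<open>n\<close> refines the partition,
  and \<open>n\<close> can be read off as the length of the name.\<close>

definition cell :: "nat \<Rightarrow> real \<Rightarrow> bool list" where
  "cell n b = map (\<lambda>i. of_rat (from_nat i) < b) [0..<n]"

lemma length_cell [simp]: "length (cell n b) = n"
  by (simp add: cell_def)

lemma cell_eq_mono: "cell n b = cell n b' \<Longrightarrow> m \<le> n \<Longrightarrow> cell m b = cell m b'"
  by (auto simp: cell_def)

lemma cell_separates:
  assumes "b \<noteq> b'"
  shows "\<exists>n. cell n b \<noteq> cell n b'"
proof -
  obtain q where "min b b' < of_rat q" "of_rat q < max b b'"
    using of_rat_dense[of "min b b'" "max b b'"] assms by fastforce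
  then have "(of_rat (from_nat (to_nat q)) < b) \<noteq> (of_rat (from_nat (to_nat q)) < b')"
    by (auto simp: min_def max_def split: if_splits)
  then have "cell (Suc (to_nat q)) b \<noteq> cell (Suc (to_nat q)) b'"
    by (auto simp: cell_def)
  then show ?thesis ..
qed

lemma cell_eventually_inj_on:
  assumes "finite S"
  shows "\<exists>n. inj_on (cell n) S"
proof -
  obtain g where g: "\<And>b b'. b \<noteq> b' \<Longrightarrow> cell (g b b') b \<noteq> cell (g b b') b'"
    using cell_separates by metis
  \<comment> \<open>For empty \<open>S\<close> this maximum is unspecified, but then there are no
    pairs to separate.\<close>
  define n where "n = Max ((\<lambda>(b, b'). g b b') ` (S \<times> S))"
  have le: "g b b' \<le> n" if "b \<in> S" "b' \<in> S" for b b'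
    unfolding n_def using assms that by (intro Max_ge) auto
  have "inj_on (cell n) S"
  proof (rule inj_onI)
    fix b b'
    assume "b \<in> S" "b' \<in> S" "cell n b = cell n b'"
    then show "b = b'"
      using g[of b b'] cell_eq_mono[of n b b' "g b b'"] le[of b b'] by blast
  qed
  then show ?thesis ..
qed

section \<open>Bits of a real number\<close>

lemma finite_to_nat_le: "finite {q :: 'a :: countable. to_nat q \<le> n}"
  using finite_vimageI[of "{..n}" "to_nat :: 'a \<Rightarrow> nat"] by (simp add: vimage_def)

text \<open>\<open>c a b\<close> models the rational coordinate of \<open>a\<close> at the Hamel
  basis element \<open>b\<close>, and is 0 if \<open>b\<close> is not in the basis. Additivity is
  the form of linearity suited to the relation a + a' = x + x.\<close>

locale coordinates =
  fixes c :: "real \<Rightarrow> real \<Rightarrow> rat"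
  assumes finite_support: "finite {b. c a b \<noteq> 0}"
    and inj: "inj c"
    and add: "c (a + a') b = c a b + c a' b"
begin

definition supp :: "real \<Rightarrow> real set" where
  "supp a = {b. c a b \<noteq> 0}"

definition part :: "bool list \<Rightarrow> real \<Rightarrow> real set" where
  "part \<sigma> a = {b \<in> supp a. cell (length \<sigma>) b = \<sigma>}"

text \<open>The bound on the codes serves twice: a given support and level admit only finitely many
  reals, and the coordinates of \<open>x\<close> occur as thresholds among the bits up to its own
  level. The code of 0 is included so that sign tests are always recorded.\<close>

definition fits :: "nat \<Rightarrow> real \<Rightarrow> bool" where
  "fits n a \<longleftrightarrow> inj_on (cell n) (supp a) \<and> to_nat (0::rat) \<le> n \<and> (\<forall>b. to_nat (c a b) \<le> n)"

definition level :: "real \<Rightarrow> nat" where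
  "level a = (LEAST n. fits n a)"

text \<open>The last kind of bit makes the level itself visible: only its length matters in \<open>\<sigma>\<close>.\<close>

fun bit :: "bool list \<times> rat \<times> nat \<Rightarrow> real \<Rightarrow> bool" where
  "bit (\<sigma>, q, k) a \<longleftrightarrow>
     (if k = 0 then odd (card (part \<sigma> a))
      else if k = 1 then part \<sigma> a \<noteq> {} \<and> c a (Min (part \<sigma> a)) > q
      else if k = 2 then part \<sigma> a - {Min (part \<sigma> a)} \<noteq> {} \<and>
        c a (Min (part \<sigma> a - {Min (part \<sigma> a)})) > q
      else length \<sigma> = level a)"

definition window :: "nat \<Rightarrow> (bool list \<times> rat \<times> nat) set" where
  "window n = {\<sigma>. length \<sigma> \<le> n} \<times> {q. to_nat q \<le> n} \<times> {..3}"

text \<open>Stopping at the point's own level keeps the set finite, so that only countably many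
  ternary sums arise.\<close>

definition bits :: "real \<Rightarrow> (bool list \<times> rat \<times> nat) set" where
  "bits a = {i \<in> window (level a). bit i a}"

lemma finite_supp: "finite (supp a)"
  using finite_support by (simp add: supp_def)

lemma finite_part: "finite (part \<sigma> a)"
  using finite_supp by (simp add: part_def)

lemma finite_window: "finite (window n)"
proof -
  have "finite {\<sigma> :: bool list. length \<sigma> \<le> n}"
    using finite_lists_length_le[of "UNIV :: bool set" n] by simp
  then show ?thesis
    by (simp add: window_def finite_to_nat_le)
qed

lemma window_mono: "m \<le> n \<Longrightarrow> window m \<subseteq> window n"
  by (auto simp: window_def)

lemma finite_bits: "finite (bits a)"
  using finite_window by (simp add: bits_def)

lemma fits_level: "fits (level a) a"
proof -
  obtain m where m: "inj_on (cell m) (supp a)"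
    using cell_eventually_inj_on finite_supp by blast
  have "range (c a) \<subseteq> insert 0 (c a ` supp a)"
    by (auto simp: supp_def)
  then have "finite (to_nat ` range (c a))"
    using finite_supp by (meson finite_imageI finite_insert finite_subset)
  then obtain k where "\<forall>i \<in> to_nat ` range (c a). i \<le> k"
    unfolding finite_nat_set_iff_bounded_le by blast
  then have k: "to_nat (c a b) \<le> k" for b
    by blast
  define n where "n = Max {m, k, to_nat (0::rat)}"
  have n: "m \<le> n" "k \<le> n" "to_nat (0::rat) \<le> n"
    by (auto simp: n_def)
  have "inj_on (cell n) (supp a)"
    using m cell_eq_mono[OF _ n(1)] by (meson inj_on_def)
  then have "fits n a"
    using k[THEN le_trans, OF n(2)] n(3) by (simp add: fits_def)
  then show ?thesis
    unfolding level_def by (rule LeastI)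
qed

lemma finite_bounded_level: "finite {a. supp a \<subseteq> S \<and> level a \<le> n}" if "finite S"
proof (rule finite_imageD)
  let ?Q = "{q :: rat. to_nat q \<le> n}"
  have "c ` {a. supp a \<subseteq> S \<and> level a \<le> n} \<subseteq>
      {g. \<forall>b. (b \<in> S \<longrightarrow> g b \<in> ?Q) \<and> (b \<notin> S \<longrightarrow> g b = 0)}"
    using fits_level by (fastforce simp: fits_def supp_def intro: le_trans)
  then show "finite (c ` {a. supp a \<subseteq> S \<and> level a \<le> n})"
    by (rule finite_subset) (intro finite_set_of_finite_funs that finite_to_nat_le)
  show "inj_on c {a. supp a \<subseteq> S \<and> level a \<le> n}"
    using inj by (rule inj_on_subset) simp
qed

section \<open>Points symmetric about x\<close>

lemma opposite_off_supp:
  assumes "a + a' = 2 * x" "b \<notin> supp x"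
  shows "c a' b = - c a b"
  using add[of a a' b] add[of x x b] assms by (simp add: supp_def)

text \<open>Everything turns on the least element \<open>m\<close> of the two parts. Off the support
  of \<open>x\<close> its coordinates would be opposite and nonzero, and the sign of the first
  coordinate would tell; so \<open>m\<close> is the only element of \<open>supp x\<close> in the
  cell.\<close>

lemma same_bits_imp_eq_on_cell:
  assumes sum: "a + a' = 2 * x"
    and inj_x: "inj_on (cell (length \<sigma>)) (supp x)"
    and parity: "bit (\<sigma>, 0, 0) a = bit (\<sigma>, 0, 0) a'"
    and first: "\<And>q. q = 0 \<or> q \<in> range (c x) \<Longrightarrow> bit (\<sigma>, q, 1) a = bit (\<sigma>, q, 1) a'"
    and second: "bit (\<sigma>, 0, 2) a = bit (\<sigma>, 0, 2) a'"
    and b: "cell (length \<sigma>) b = \<sigma>"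
  shows "c a b = c a' b"
proof (cases "part \<sigma> a \<union> part \<sigma> a' = {}")
  case True
  then have "b \<notin> supp a" "b \<notin> supp a'"
    using b by (auto simp: part_def)
  then show ?thesis
    by (simp add: supp_def)
next
  case False
  define m where "m = Min (part \<sigma> a \<union> part \<sigma> a')"
  have m: "m \<in> part \<sigma> a \<union> part \<sigma> a'"
    unfolding m_def using False finite_part by (intro Min_in) auto
  have m_le: "m \<le> y" if "y \<in> part \<sigma> a \<or> y \<in> part \<sigma> a'" for y
    unfolding m_def using that finite_part by (intro Min_le) auto
  have Min_a: "Min (part \<sigma> a) = m" if "m \<in> part \<sigma> a"
    using that m_le finite_part by (intro Min_eqI) auto
  have Min_a': "Min (part \<sigma> a') = m" if "m \<in> part \<sigma> a'"
    using that m_le finite_part by (intro Min_eqI) auto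
  have m_x: "m \<in> supp x"
  proof (rule ccontr)
    assume "m \<notin> supp x"
    then have opp: "c a' m = - c a m"
      using opposite_off_supp[OF sum] by simp
    then have in_both: "m \<in> part \<sigma> a" "m \<in> part \<sigma> a'"
      using m by (auto simp: part_def supp_def)
    then have "c a m \<noteq> 0"
      by (simp add: part_def supp_def)
    then show False
      using first[of 0] in_both Min_a Min_a' opp by auto
  qed
  have opp: "c a' y = - c a y" if "cell (length \<sigma>) y = \<sigma>" "y \<noteq> m" for y
  proof -
    have "y \<notin> supp x"
    proof
      assume "y \<in> supp x"
      moreover have "cell (length \<sigma>) y = cell (length \<sigma>) m"
        using m that(1) unfolding part_def by force
      ultimately show False
        using inj_onD[OF inj_x] m_x that(2) by blast
    qed
    then show ?thesis
      using opposite_off_supp[OF sum] by simp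
  qed
  have rest: "part \<sigma> a - {m} = part \<sigma> a' - {m}"
    using opp by (auto simp: part_def supp_def)
  \<comment> \<open>The parts agree off \<open>m\<close>, so if only one contained \<open>m\<close>,
    their cardinalities would differ by one.\<close>
  have in_both: "m \<in> part \<sigma> a \<and> m \<in> part \<sigma> a'"
  proof (rule ccontr)
    assume "\<not> ?thesis"
    then consider "part \<sigma> a = insert m (part \<sigma> a')" "m \<notin> part \<sigma> a'"
      | "part \<sigma> a' = insert m (part \<sigma> a)" "m \<notin> part \<sigma> a"
      using m rest by blast
    then show False
      using parity finite_part by cases auto
  qed
  then have Mins: "Min (part \<sigma> a) = m" "Min (part \<sigma> a') = m"
    using Min_a Min_a' by auto
  have "c a m + c a' m = 2 * c x m"
    using add[of a a' m] add[of x x m] sum by simp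
  \<comment> \<open>\<open>c x m\<close> is the mean of the two coordinates; if they differed,
    exactly one would exceed it.\<close>
  moreover have "(c a m > c x m) = (c a' m > c x m)"
    using first[of "c x m"] in_both Mins by auto
  ultimately have eq: "c a m = c a' m"
    by linarith
  \<comment> \<open>A second smallest element would be common to both parts and carry opposite signs
    there.\<close>
  have "part \<sigma> a - {m} = {}"
  proof (rule ccontr)
    assume ne: "part \<sigma> a - {m} \<noteq> {}"
    define m2 where "m2 = Min (part \<sigma> a - {m})"
    have "m2 \<in> part \<sigma> a - {m}"
      unfolding m2_def using ne finite_part by (intro Min_in) auto
    then have "c a' m2 = - c a m2" "c a m2 \<noteq> 0"
      using opp by (auto simp: part_def supp_def)
    moreover have "(c a m2 > 0) = (c a' m2 > 0)"
      using second ne rest Mins by (auto simp: m2_def)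
    ultimately show False
      by auto
  qed
  then have "b = m \<or> b \<notin> part \<sigma> a \<and> b \<notin> part \<sigma> a'"
    using rest by blast
  then show ?thesis
    using eq b by (auto simp: part_def supp_def)
qed

text \<open>If either point stops within the window of \<open>x\<close>, the level bit makes both
  stop at the same level. Otherwise every bit in the window is recorded for both points, the cells
  of \<open>x\<close> give a = a', and hence a = x.\<close>

lemma same_bits_imp_exceptional:
  assumes sum: "a + a' = 2 * x"
    and same: "bits a \<inter> window (level x) = bits a' \<inter> window (level x)"
  shows "supp a \<subseteq> supp x \<and> level a \<le> level x"
proof -
  define N where "N = level x"
  have zero: "to_nat (0::rat) \<le> level y" for y
    using fits_level by (simp add: fits_def)
  have same': "i \<in> bits a \<longleftrightarrow> i \<in> bits a'" if "i \<in> window N" for i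
    using same that by (auto simp: N_def)
  \<comment> \<open>Any list of length \<open>level y\<close> would serve; the threshold 0 is
    admissible at every level.\<close>
  have stop: "(replicate (level y) True, 0, 3) \<in> bits y" for y
    using zero[of y] by (simp add: bits_def window_def)
  have stop_window: "(replicate (level y) True, 0, 3) \<in> window N" if "level y \<le> N" for y
    using that zero[of x] by (auto simp: N_def window_def)
  have "level a = level a'" if "level a \<le> N \<or> level a' \<le> N"
    using that
  proof
    assume "level a \<le> N"
    then have "(replicate (level a) True, 0, 3) \<in> bits a'"
      using same' stop_window stop by blast
    then show ?thesis
      by (simp add: bits_def)
  next
    assume "level a' \<le> N"
    then have "(replicate (level a') True, 0, 3) \<in> bits a"
      using same' stop_window stop by blast
    then show ?thesis
      by (simp add: bits_def)
  qed
  then consider "level a = level a'" "level a \<le> N" | "level a > N" "level a' > N"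
    by linarith
  then show ?thesis
  proof cases
    case 1
    have "b \<in> supp x" if b: "b \<in> supp a" for b
    proof (rule ccontr)
      assume "b \<notin> supp x"
      then have opp: "c a' b = - c a b"
        using opposite_off_supp[OF sum] by simp
      define \<sigma> where "\<sigma> = cell (level a) b"
      have single: "part \<sigma> y = {b}" if "level y = level a" "b \<in> supp y" for y
        using fits_level[of y] that by (auto simp: part_def \<sigma>_def fits_def inj_on_def)
      have parts: "part \<sigma> a = {b}" "part \<sigma> a' = {b}"
        using single[of a] single[of a'] 1 b opp by (auto simp: supp_def)
      have "(\<sigma>, 0, 1) \<in> window (level a)"
        using zero[of a] by (simp add: window_def \<sigma>_def)
      \<comment> \<open>Both parts being \<open>{b}\<close>, this bit is the sign of the coordinate
        at \<open>b\<close>, which is opposite for the two points.\<close>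
      then have "bit (\<sigma>, 0, 1) a = bit (\<sigma>, 0, 1) a'"
        using same'[of "(\<sigma>, 0, 1)"] window_mono[OF 1(2)] 1(1) by (auto simp: bits_def)
      then show False
        using parts opp b by (auto simp: supp_def)
    qed
    then show ?thesis
      using 1 by (auto simp: N_def)
  next
    case 2
    have bit_same: "bit i a = bit i a'" if "i \<in> window N" for i
      using same'[OF that] that window_mono[of N "level a"] window_mono[of N "level a'"] 2
      by (auto simp: bits_def)
    have "c a b = c a' b" for b
    proof (rule same_bits_imp_eq_on_cell[OF sum, of "cell N b"])
      show "inj_on (cell (length (cell N b))) (supp x)"
        using fits_level[of x] by (simp add: fits_def N_def)
      show "bit (cell N b, 0, 0) a = bit (cell N b, 0, 0) a'"
        "bit (cell N b, 0, 2) a = bit (cell N b, 0, 2) a'"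
        using zero[of x] by (auto intro!: bit_same simp: window_def N_def simp del: bit.simps)
      \<comment> \<open>The thresholds taken from \<open>x\<close> lie in the window because the
        level of \<open>x\<close> bounds the codes of its coordinates.\<close>
      show "bit (cell N b, q, 1) a = bit (cell N b, q, 1) a'" if "q = 0 \<or> q \<in> range (c x)" for q
        using that zero[of x] fits_level[of x]
        by (auto intro!: bit_same simp: window_def N_def fits_def simp del: bit.simps)
    qed simp
    then have "a = a'"
      using inj by (auto dest: injD)
    then show ?thesis
      using sum by simp
  qed
qed

lemma finite_same_bits:
  "finite {s. bits (x - s) \<inter> window (level x) = bits (x + s) \<inter> window (level x)}"
proof (rule finite_subset)
  show "{s. bits (x - s) \<inter> window (level x) = bits (x + s) \<inter> window (level x)} \<subseteq>
      (\<lambda>a. x - a) ` {a. supp a \<subseteq> supp x \<and> level a \<le> level x}"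
  proof
    fix s
    assume "s \<in> {s. bits (x - s) \<inter> window (level x) = bits (x + s) \<inter> window (level x)}"
    then have "x - s \<in> {a. supp a \<subseteq> supp x \<and> level a \<le> level x}"
      using same_bits_imp_exceptional[of "x - s" "x + s" x] by simp
    then show "s \<in> (\<lambda>a. x - a) ` {a. supp a \<subseteq> supp x \<and> level a \<le> level x}"
      by (intro image_eqI[of _ _ "x - s"]) simp_all
  qed
  show "finite ((\<lambda>a. x - a) ` {a. supp a \<subseteq> supp x \<and> level a \<le> level x})"
    by (intro finite_imageI finite_bounded_level finite_supp)
qed

section \<open>The function and its range\<close>

definition antisym_fun :: "real \<Rightarrow> real" where
  "antisym_fun a = ternary (to_nat ` bits a)"

lemma countable_range_antisym_fun: "countable (range antisym_fun)"
proof (rule countable_subset)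
  show "range antisym_fun \<subseteq> ternary ` {A. finite A}"
    using finite_bits by (auto simp: antisym_fun_def)
  show "countable (ternary ` {A. finite A})"
    using countable_Collect_finite by blast
qed

lemma bounded_range_antisym_fun: "bounded (range antisym_fun)"
proof -
  have "\<bar>antisym_fun a\<bar> \<le> 3/2" for a
    using ternary_tail_le[of "to_nat ` bits a" 0] ternary_nonneg[of "to_nat ` bits a"]
    by (simp add: antisym_fun_def finite_bits)
  then show ?thesis
    by (intro boundedI[of _ "3/2"]) auto
qed

lemma finite_close_antisym_fun:
  "\<exists>\<epsilon>>0. finite {s. \<bar>antisym_fun (x - s) - antisym_fun (x + s)\<bar> < \<epsilon>}"
proof -
  \<comment> \<open>Once \<open>N\<close> exceeds all codes in the window, values closer than
    (1/3)^N force agreement on the whole window.\<close>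
  obtain N where N: "to_nat ` window (level x) \<subseteq> {..<N}"
    using finite_nat_iff_bounded[of "to_nat ` window (level x)"] finite_window by blast
  have "bits (x - s) \<inter> window (level x) = bits (x + s) \<inter> window (level x)"
    if close: "\<bar>antisym_fun (x - s) - antisym_fun (x + s)\<bar> < (1/3) ^ N" for s
  proof -
    have "to_nat ` bits (x - s) \<inter> {..<N} = to_nat ` bits (x + s) \<inter> {..<N}"
      using close finite_bits unfolding antisym_fun_def
      by (intro ternary_less_imp_same_digits) auto
    then have "i \<in> bits (x - s) \<longleftrightarrow> i \<in> bits (x + s)" if "to_nat i < N" for i
      using that by (metis IntD1 IntI imageI inj_image_mem_iff inj_to_nat lessThan_iff)
    then show ?thesis
      using N by blast
  qed
  then have "finite {s. \<bar>antisym_fun (x - s) - antisym_fun (x + s)\<bar> < (1/3) ^ N}"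
    by (intro finite_subset[OF _ finite_same_bits[of x]]) blast
  then show ?thesis
    by (intro exI[of _ "(1/3) ^ N"]) simp
qed

end

section \<open>Hamel coordinates\<close>

lemma hamel_coordinates: "\<exists>c. coordinates c"
proof -
  interpret V: vector_space "\<lambda>(q::rat) (x::real). of_rat q * x"
    by unfold_locales (simp_all add: algebra_simps of_rat_add of_rat_mult)
  define B where "B = V.extend_basis {}"
  have indep: "V.independent B" and span: "V.span B = UNIV"
    unfolding B_def
    by (simp_all add: V.independent_extend_basis V.span_extend_basis V.independent_empty)
  have "coordinates (V.representation B)"
  proof
    show "finite {b. V.representation B a b \<noteq> 0}" for a
      by (rule V.finite_representation)
    show "V.representation B (a + a') b = V.representation B a b + V.representation B a' b"
      for a a' b
      by (simp add: V.representation_add[OF indep] span)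
    show "inj (V.representation B)"
    proof (rule injI)
      fix a a' :: real
      assume eq: "V.representation B a = V.representation B a'"
      \<comment> \<open>A real is recovered from its coordinates, which gives injectivity.\<close>
      have "(\<Sum>b | V.representation B y b \<noteq> 0. of_rat (V.representation B y b) * b) = y" for y
        by (rule V.sum_nonzero_representation_eq[OF indep]) (simp add: span)
      then show "a = a'"
        using eq by metis
    qed
  qed
  then show ?thesis
    by (rule exI[of _ "V.representation B"])
qed

lemma uniformly_antisymmetric_if_finite_close:
  assumes "\<And>x. \<exists>\<epsilon>>0. finite {s. \<bar>f (x - s) - f (x + s)\<bar> < \<epsilon>}"
  shows "uniformly_antisymmetric f"
  unfolding uniformly_antisymmetric_def
proof (intro allI notI, elim exE conjE)
  fix x and s :: "nat \<Rightarrow> real"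
  assume nz: "\<forall>n. s n \<noteq> 0" and s: "s \<longlonglongrightarrow> 0"
    and lim: "(\<lambda>n. f (x + s n) - f (x - s n)) \<longlonglongrightarrow> 0"
  obtain \<epsilon> where "\<epsilon> > 0" and fin: "finite {s. \<bar>f (x - s) - f (x + s)\<bar> < \<epsilon>}"
    using assms by blast
  have "\<forall>\<^sub>F n in sequentially. \<bar>f (x - s n) - f (x + s n)\<bar> < \<epsilon>"
    using tendstoD[OF lim \<open>\<epsilon> > 0\<close>] by (simp add: dist_real_def abs_minus_commute)
  \<comment> \<open>The point 0 always belongs to the finite set. Without it the set is closed and
    misses the limit 0, so the sequence eventually avoids it; nonzero terms then cannot lie in the
    full set either.\<close>
  moreover have "\<forall>\<^sub>F n in sequentially.
      s n \<in> - ({s. \<bar>f (x - s) - f (x + s)\<bar> < \<epsilon>} - {0})"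
    using fin by (intro topological_tendstoD[OF s] open_Compl finite_imp_closed) simp_all
  ultimately have "\<forall>\<^sub>F n in sequentially. False"
    by eventually_elim (use nz in auto)
  then show False
    by simp
qed

theorem theorem1:
  "\<exists>f :: real \<Rightarrow> real.
    countable (range f) \<and> bounded (range f) \<and>
    (\<forall>x. \<exists>\<epsilon>>0. finite {s. \<bar>f (x - s) - f (x + s)\<bar> < \<epsilon>}) \<and>
    uniformly_antisymmetric f"
proof -
  obtain c where "coordinates c"
    using hamel_coordinates by blast
  then interpret coordinates c .
  show ?thesis
    using countable_range_antisym_fun bounded_range_antisym_fun finite_close_antisym_fun
      uniformly_antisymmetric_if_finite_close
    by blast
qed

end
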